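(* Let $d\in\mathbb{Z}_+$ and let $\mathcal{G}$ be a non-degenerate Hessenberg matrix. Then $\mathcal{G}$ is a Hessenberg-Sobolev matrix of index $d$ if and only if $$\Psi(\mathcal{G},2d+1)=\mathcal{O}\quad\text{and}\quad\Psi(\mathcal{G},2d)\neq\mathcal{O}.$$
   Context: $\mathbb{Z}_+=\{0,1,2,\dots\}$. Infinite matrices have real entries indexed by $(i,j)\in\mathbb{Z}_+\times\mathbb{Z}_+$; $\mathcal{O}$ is the infinite null matrix and $\mathcal{I}$ the infinite unit matrix. All products of infinite matrices considered are such that each entry is a sum with finitely many nonzero terms. $\mathcal{U}$ is the infinite matrix with $(i,j)$ entry $\delta_{i+1,j}$; $\mathcal{U}^{-1}:=\mathcal{U}^{\mathsf T}$ is its right-hand inverse and $\mathcal{U}^{-m}:=(\mathcal{U}^{-1})^m$. A non-degenerate Hessenberg matrix is an infinite real matrix $\mathcal{G}=(g_{i,j})_{i,j\ge0}$ with $g_{i,j}=0$ whenever $j-i>1$ and $g_{i,i+1}\neq 0$ for all $i\ge 0$. The sequence of polynomials $\{Q_n\}_{n\ge 0}$ generated by $\mathcal{G}$ is defined by $Q_0=t_{0,0}$ (a fixed constant $t_{0,0}>0$) and $g_{n,n+1}Q_{n+1}(x)=xQ_n(x)-\sum_{k=0}^n g_{n,k}Q_k(x)$ for $n\ge 0$; thus $\deg Q_n=n$. Write $Q_n(x)=\sum_{i=0}^n t_{n,i}x^i$ and let $\mathcal{T}=(t_{n,i})$ be the corresponding lower triangular infinite matrix ($t_{n,i}=0$ for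 $i>n$); it has nonzero diagonal entries and a unique two-sided (lower triangular) inverse $\mathcal{T}^{-1}$. Let $\mathcal{T}^{-\mathsf T}=(\mathcal{T}^{-1})^{\mathsf T}$. The matrix of formal moments associated with $\mathcal{G}$ is $\mathcal{M}_{\mathcal{G}}:=\mathcal{T}^{-1}\mathcal{T}^{-\mathsf T}$. A matrix $\mathcal{H}=(h_{i,j})$ is Hankel if $h_{i,j+1}=h_{i+1,j}$ for all $i,j\ge 0$. $\mathcal{D}_0=\mathcal{I}$ and, for $k>0$, $\mathcal{D}_k$ is the infinite diagonal matrix with $i$th diagonal entry $\frac{(k+i)!}{i!}$, $i\ge0$. A matrix $\mathcal{M}$ is a Hankel-Sobolev matrix if there is a sequence of Hankel matrices $\{\mathcal{H}_k\}_{k=0}^\infty$ with $\mathcal{M}=\sum_{k=0}^{\infty}\mathcal{U}^{-k}\mathcal{D}_k\mathcal{H}_k\mathcal{D}_k\mathcal{U}^{k}$; it is of index $d\in\mathbb{Z}_+$ if $\mathcal{H}_d\neq\mathcal{O}$ and $\mathcal{H}_k=\mathcal{O}$ for all $k>d$. $\mathcal{G}$ is a Hessenberg-Sobolev matrix of index $d$ if $\mathcal{M}_{\mathcal{G}}$ is a Hankel-Sobolev matrix of index $d$. For $\eta\in\mathbb{Z}_+$ and a lower Hessenberg infinite matrix $\mathcal{B}$, $\Psi(\mathcal{B},\eta):=\sum_{k=0}^{\eta}(-1)^k\binom{\eta}{k}\,\mathcal{B}^k\,\mathcal{B}^{(\eta-k)\mathsf T}$, where $\mathcal{B}^{m\mathsf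 T}=(\mathcal{B}^m)^{\mathsf T}$. *)

theory Defs
  imports Complex_Main "HOL-Library.Groups_Big_Fun" "HOL-Computational_Algebra.Polynomial"
begin

type_synonym imat = "nat \<Rightarrow> nat \<Rightarrow> real"

definition null_imat :: imat  ("\<O>") where
  "\<O> = (\<lambda>i j. 0)"

definition unit_imat :: imat  ("\<I>") where
  "\<I> = (\<lambda>i j. if i = j then 1 else 0)"

definition transpose_imat :: "imat \<Rightarrow> imat"  ("_\<^sup>T" [1000] 1000) where
  "A\<^sup>T = (\<lambda>i j. A j i)"

(* Sum_any is the sum over the support of its argument, with junk value 0 if the
   support is infinite. Every product below has only finitely many nonzero terms per
   entry: the left factor is row-finite or the right factor is column-finite. *)
definition mult_imat :: "imat \<Rightarrow> imat \<Rightarrow> imat"  (infixl "\<odot>" 70) where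
  "A \<odot> B = (\<lambda>i j. Sum_any (\<lambda>k. A i k * B k j))"

primrec pow_imat :: "imat \<Rightarrow> nat \<Rightarrow> imat" where
  "pow_imat A 0 = \<I>"
| "pow_imat A (Suc n) = A \<odot> pow_imat A n"

definition shift_imat :: imat  ("\<U>") where
  "\<U> = (\<lambda>i j. if i + 1 = j then 1 else 0)"

(* The diagonal entries are all 1 for k = 0, so that diag_imat 0 is the unit matrix. *)
definition diag_imat :: "nat \<Rightarrow> imat"  ("\<D>") where
  "\<D> k = (\<lambda>i j. if i = j then fact (k + i) / fact i else 0)"

definition lower_triangular :: "imat \<Rightarrow> bool" where
  "lower_triangular A \<longleftrightarrow> (\<forall>i j. i < j \<longrightarrow> A i j = 0)"

(* Meant for lower triangular matrices with nonzero diagonal entries, which have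
   exactly one lower triangular two-sided inverse. *)
definition lt_inverse :: "imat \<Rightarrow> imat" where
  "lt_inverse A = (THE B. lower_triangular B \<and> A \<odot> B = \<I> \<and> B \<odot> A = \<I>)"

definition nondegenerate_hessenberg :: "imat \<Rightarrow> bool" where
  "nondegenerate_hessenberg G \<longleftrightarrow>
     (\<forall>i j. i + 1 < j \<longrightarrow> G i j = 0) \<and> (\<forall>i. G i (i + 1) \<noteq> 0)"

(* The recurrence g_{n,n+1} Q_{n+1}(x) = x Q_n(x) - sum_{k=0}^n g_{n,k} Q_k(x),
   solved for Q_{n+1}; the polynomial [:0, 1:] is x. *)
fun gen_poly :: "imat \<Rightarrow> real \<Rightarrow> nat \<Rightarrow> real poly" where
  "gen_poly G t00 0 = [:t00:]"
| "gen_poly G t00 (Suc n) =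
     smult (1 / G n (n + 1))
       ([:0, 1:] * gen_poly G t00 n - (\<Sum>k\<in>{0..n}. smult (G n k) (gen_poly G t00 k)))"

definition coeff_imat :: "imat \<Rightarrow> real \<Rightarrow> imat" where
  "coeff_imat G t00 = (\<lambda>n i. coeff (gen_poly G t00 n) i)"

definition moment_imat :: "imat \<Rightarrow> real \<Rightarrow> imat" where
  "moment_imat G t00 =
     lt_inverse (coeff_imat G t00) \<odot> (lt_inverse (coeff_imat G t00))\<^sup>T"

definition hankel :: "imat \<Rightarrow> bool" where
  "hankel H \<longleftrightarrow> (\<forall>i j. H i (j + 1) = H (i + 1) j)"

(* Conjugating by the k-th power of the shift moves a matrix k places down and right,
   so entry (i, j) of the k-th summand vanishes for k > min i j. *)
definition hankel_sobolev_sum :: "(nat \<Rightarrow> imat) \<Rightarrow> imat" where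
  "hankel_sobolev_sum H =
     (\<lambda>i j. Sum_any (\<lambda>k. (pow_imat (\<U>\<^sup>T) k \<odot> \<D> k \<odot> H k \<odot> \<D> k \<odot> pow_imat \<U> k) i j))"

definition hankel_sobolev_of_index :: "imat \<Rightarrow> nat \<Rightarrow> bool" where
  "hankel_sobolev_of_index M d \<longleftrightarrow>
     (\<exists>H. (\<forall>k. hankel (H k)) \<and> M = hankel_sobolev_sum H \<and>
          H d \<noteq> \<O> \<and> (\<forall>k>d. H k = \<O>))"

definition hessenberg_sobolev_of_index :: "imat \<Rightarrow> real \<Rightarrow> nat \<Rightarrow> bool" where
  "hessenberg_sobolev_of_index G t00 d \<longleftrightarrow> hankel_sobolev_of_index (moment_imat G t00) d"

definition Psi :: "imat \<Rightarrow> nat \<Rightarrow> imat"  ("\<Psi>") where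
  "\<Psi> B \<eta> = (\<lambda>i j. \<Sum>k\<in>{0..\<eta>}.
     (-1) ^ k * real (\<eta> choose k) * (pow_imat B k \<odot> (pow_imat B (\<eta> - k))\<^sup>T) i j)"

end

theory Submission
  imports Defs
begin

text \<open>
  The recurrence says \<open>G T = T U\<close>, so \<open>\<Psi> G \<eta> = T \<Phi> T\<^sup>T\<close>, where the \<open>(i, j)\<close> entry of \<open>\<Phi>\<close> is an
  alternating \<open>\<eta>\<close>-th difference of the moment matrix along the antidiagonal \<open>i + j + \<eta>\<close>. Along an
  antidiagonal the \<open>k\<close>-th Hankel-Sobolev summand is a polynomial of degree \<open>2 k\<close> in the row index,
  so the \<open>2 k\<close>-th difference reads off the Hankel matrix \<open>H k\<close> and higher differences vanish.
  Conversely every symmetric matrix is a Hankel-Sobolev sum: the coefficients on an antidiagonal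
  solve a triangular system on its first half, and symmetry gives the second half. The vanishing of
  the differences then forces \<open>H k = \<O>\<close> for all \<open>k > d\<close>.
\<close>

subsection \<open>Row-finite matrices\<close>

text \<open>A row-finite left factor makes every entry of a product a finite sum. Unlike the
  Hessenberg shape, this property passes to products and powers.\<close>

definition row_finite :: "imat \<Rightarrow> bool" where
  "row_finite A \<longleftrightarrow> (\<forall>i. finite {k. A i k \<noteq> 0})"

lemma transpose_imat_apply [simp]: "A\<^sup>T i j = A j i"
  by (simp add: transpose_imat_def)

lemma transpose_transpose_imat [simp]: "(A\<^sup>T)\<^sup>T = A"
  by (simp add: transpose_imat_def)

lemma transpose_mult_imat: "(A \<odot> B)\<^sup>T = B\<^sup>T \<odot> A\<^sup>T"
  by (simp add: transpose_imat_def mult_imat_def mult.commute)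

lemma transpose_unit_imat [simp]: "\<I>\<^sup>T = \<I>"
  by (auto simp: transpose_imat_def unit_imat_def fun_eq_iff)

lemma Sum_any_single:
  fixes f :: "'a \<Rightarrow> real"
  assumes "\<And>k. k \<noteq> a \<Longrightarrow> f k = 0"
  shows "Sum_any f = f a"
proof -
  have "Sum_any f = sum f {a}"
    by (rule Sum_any.expand_superset) (use assms in auto)
  then show ?thesis by simp
qed

lemma unit_mult_imat [simp]: "\<I> \<odot> A = A"
proof (intro ext)
  fix i j
  show "(\<I> \<odot> A) i j = A i j"
    unfolding mult_imat_def by (subst Sum_any_single[where a = i]) (auto simp: unit_imat_def)
qed

lemma mult_unit_imat [simp]: "A \<odot> \<I> = A"
proof (intro ext)
  fix i j
  show "(A \<odot> \<I>) i j = A i j"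
    unfolding mult_imat_def by (subst Sum_any_single[where a = j]) (auto simp: unit_imat_def)
qed

lemma row_finite_mult:
  assumes "row_finite A" "row_finite B"
  shows "row_finite (A \<odot> B)"
  unfolding row_finite_def
proof
  fix i
  have "{l. (A \<odot> B) i l \<noteq> 0} \<subseteq> (\<Union>k\<in>{k. A i k \<noteq> 0}. {l. B k l \<noteq> 0})"
    unfolding mult_imat_def by (auto elim!: Sum_any.not_neutral_obtains_not_neutral)
  moreover have "finite (\<Union>k\<in>{k. A i k \<noteq> 0}. {l. B k l \<noteq> 0})"
    using assms by (auto simp: row_finite_def)
  ultimately show "finite {l. (A \<odot> B) i l \<noteq> 0}"
    by (rule finite_subset)
qed

lemma row_finite_upper_band:
  assumes "\<And>i j. i + m < j \<Longrightarrow> A i j = 0"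
  shows "row_finite A"
  unfolding row_finite_def
proof
  fix i
  have "{k. A i k \<noteq> 0} \<subseteq> {..i + m}"
    using assms by (force simp: not_less[symmetric])
  then show "finite {k. A i k \<noteq> 0}"
    by (rule finite_subset) simp
qed

lemma row_finite_unit: "row_finite \<I>"
  by (rule row_finite_upper_band[of 0]) (auto simp: unit_imat_def)

lemma row_finite_pow: "row_finite A \<Longrightarrow> row_finite (pow_imat A n)"
  by (induction n) (auto intro: row_finite_unit row_finite_mult)

lemma row_finite_lower_triangular: "lower_triangular A \<Longrightarrow> row_finite A"
  by (rule row_finite_upper_band[of 0]) (auto simp: lower_triangular_def)

text \<open>Products of infinite matrices do not associate in general. Here each double sum has its
  support in a finite set \<open>L \<times> K\<close>, so the summations may be exchanged;
  \<open>row_finite (C\<^sup>T)\<close> says that the columns of \<open>C\<close> are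
  finite.\<close>

lemma mult_imat_assoc:
  assumes A: "row_finite A" and BC: "row_finite B \<or> row_finite (C\<^sup>T)"
  shows "A \<odot> B \<odot> C = A \<odot> (B \<odot> C)"
proof (intro ext)
  fix i j
  define K where "K = {k. A i k \<noteq> 0}"
  have K: "finite K" using A by (simp add: row_finite_def K_def)
  obtain L where L: "finite L" "\<And>k l. A i k * B k l * C l j \<noteq> 0 \<Longrightarrow> l \<in> L"
  proof (cases "row_finite B")
    case True
    show ?thesis
      by (rule that[of "\<Union>k\<in>K. {l. B k l \<noteq> 0}"]) (use True K in \<open>auto simp: row_finite_def K_def\<close>)
  next
    case False
    with BC have "row_finite (C\<^sup>T)" by simp
    then show ?thesis
      by (intro that[of "{l. C l j \<noteq> 0}"]) (auto simp: row_finite_def)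
  qed
  have finA: "finite {k. A i k * B k l \<noteq> 0}" for l
    by (rule finite_subset[OF _ K]) (auto simp: K_def)
  have finB: "finite {l. B k l * C l j \<noteq> 0}" for k
    using BC
  proof
    assume "row_finite B"
    then have "finite {l. B k l \<noteq> 0}" by (simp add: row_finite_def)
    then show ?thesis by (rule finite_subset[rotated]) auto
  next
    assume "row_finite (C\<^sup>T)"
    then have "finite {l. C l j \<noteq> 0}" by (simp add: row_finite_def)
    then show ?thesis by (rule finite_subset[rotated]) auto
  qed
  have "(A \<odot> B \<odot> C) i j = Sum_any (\<lambda>l. Sum_any (\<lambda>k. A i k * B k l * C l j))"
    unfolding mult_imat_def by (simp add: Sum_any_left_distrib[OF finA])
  also have "\<dots> = Sum_any (\<lambda>k. Sum_any (\<lambda>l. A i k * B k l * C l j))"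
    by (rule Sum_any.swap[of "L \<times> K"]) (use K L in \<open>auto simp: K_def\<close>)
  also have "\<dots> = (A \<odot> (B \<odot> C)) i j"
    unfolding mult_imat_def by (simp add: Sum_any_right_distrib[OF finB] mult.assoc)
  finally show "(A \<odot> B \<odot> C) i j = (A \<odot> (B \<odot> C)) i j" .
qed

lemma mult_imat_upper_band:
  assumes "\<And>k. n < k \<Longrightarrow> A i k = 0"
  shows "(A \<odot> B) i j = (\<Sum>k\<le>n. A i k * B k j)"
  unfolding mult_imat_def
  by (rule Sum_any.expand_superset) (use assms in \<open>force simp: not_less[symmetric]\<close>)+

subsection \<open>Lower triangular systems and inverses\<close>

text \<open>Forward substitution for \<open>A x = f\<close>; it yields both the triangular inverses
  and, later, the Hankel coefficients.\<close>

fun forward_subst :: "imat \<Rightarrow> (nat \<Rightarrow> real) \<Rightarrow> nat \<Rightarrow> real" where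
  "forward_subst A f i = (f i - (\<Sum>k\<in>{..<i}. A i k * forward_subst A f k)) / A i i"

declare forward_subst.simps [simp del]

lemma forward_subst_solves:
  assumes "A i i \<noteq> 0"
  shows "(\<Sum>k\<le>i. A i k * forward_subst A f k) = f i"
proof -
  have "A i i * forward_subst A f i = f i - (\<Sum>k<i. A i k * forward_subst A f k)"
    using assms by (subst forward_subst.simps) simp
  then show ?thesis
    by (simp add: lessThan_Suc_atMost[symmetric])
qed

text \<open>Column \<open>j\<close> of \<open>B\<close> solves the system whose right side is the
  \<open>j\<close>th unit vector, so it vanishes above row \<open>j\<close> and starts with
  \<open>1 / A j j\<close>.\<close>

lemma ex_right_inverse:
  assumes lt: "lower_triangular A" and diag: "\<And>i. A i i \<noteq> 0"
  shows "\<exists>B. lower_triangular B \<and> (\<forall>i. B i i \<noteq> 0) \<and> A \<odot> B = \<I>"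
proof -
  define B where "B i j = forward_subst A (\<lambda>i. \<I> i j) i" for i j
  have AB: "A \<odot> B = \<I>"
  proof (intro ext)
    fix i j
    have "(A \<odot> B) i j = (\<Sum>k\<le>i. A i k * B k j)"
      by (rule mult_imat_upper_band) (use lt in \<open>auto simp: lower_triangular_def\<close>)
    then show "(A \<odot> B) i j = \<I> i j"
      by (simp add: B_def forward_subst_solves diag)
  qed
  have zero: "B i j = 0" if "i < j" for i j
    using that
  proof (induction i rule: less_induct)
    case (less i)
    have "(\<Sum>k<i. A i k * B k j) = 0"
      using less by (intro sum.neutral) auto
    with less.prems show ?case
      by (simp add: B_def forward_subst.simps[of _ _ i] unit_imat_def)
  qed
  have "B i i \<noteq> 0" for i
  proof -
    have "(\<Sum>k<i. A i k * B k i) = 0"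
      by (intro sum.neutral) (auto simp: zero)
    then show ?thesis
      using diag[of i] by (simp add: B_def forward_subst.simps[of _ _ i] unit_imat_def)
  qed
  with AB zero show ?thesis
    by (auto simp: lower_triangular_def)
qed

text \<open>The right inverse \<open>B\<close> has a right inverse \<open>C\<close> in turn, and
  \<open>A = A (B C) = (A B) C = C\<close> makes \<open>B\<close> two-sided. The same regrouping
  gives uniqueness.\<close>

lemma lt_inverse:
  assumes lt: "lower_triangular A" and diag: "\<And>i. A i i \<noteq> 0"
  shows "lower_triangular (lt_inverse A)" "A \<odot> lt_inverse A = \<I>" "lt_inverse A \<odot> A = \<I>"
proof -
  obtain B where B: "lower_triangular B" "\<And>i. B i i \<noteq> 0" "A \<odot> B = \<I>"
    using ex_right_inverse[OF assms] by blast
  obtain C where C: "lower_triangular C" "B \<odot> C = \<I>"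
    using ex_right_inverse[OF B(1,2)] by blast
  note fin = row_finite_lower_triangular
  have "A = A \<odot> (B \<odot> C)" by (simp add: C)
  also have "\<dots> = C"
    by (subst mult_imat_assoc[symmetric]) (simp_all add: fin B C lt)
  finally have BA: "B \<odot> A = \<I>" using C by simp
  let ?P = "\<lambda>B. lower_triangular B \<and> A \<odot> B = \<I> \<and> B \<odot> A = \<I>"
  have "?P (lt_inverse A)"
    unfolding lt_inverse_def
  proof (rule theI[where P = ?P and a = B])
    show "?P B" using B BA by simp
  next
    fix B' assume B': "?P B'"
    then have "B' = B' \<odot> (A \<odot> B)" by (simp add: B)
    also have "\<dots> = B"
      using B' by (subst mult_imat_assoc[symmetric]) (simp_all add: fin B lt)
    finally show "B' = B" .
  qed
  then show "lower_triangular (lt_inverse A)" "A \<odot> lt_inverse A = \<I>" "lt_inverse A \<odot> A = \<I>"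
    by auto
qed

subsection \<open>Alternating differences along antidiagonals\<close>

text \<open>Pascal's rule splits the sum in two, and an index shift in one of the halves lets them
  recombine.\<close>

lemma alternating_binomial_Suc:
  fixes f :: "nat \<Rightarrow> real"
  shows "(\<Sum>k\<le>Suc n. (-1) ^ k * real (Suc n choose k) * f k) =
    (\<Sum>k\<le>n. (-1) ^ k * real (n choose k) * (f k - f (Suc k)))"
proof -
  have "(\<Sum>k\<le>Suc n. (-1) ^ k * real (Suc n choose k) * f k) =
      f 0 + (\<Sum>k\<le>n. - ((-1) ^ k * real (n choose Suc k) * f (Suc k)))
        - (\<Sum>k\<le>n. (-1) ^ k * real (n choose k) * f (Suc k))"
    by (subst sum.atMost_Suc_shift)
       (simp add: algebra_simps sum.distrib sum_subtractf sum_negf)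
  also have "f 0 + (\<Sum>k\<le>n. - ((-1) ^ k * real (n choose Suc k) * f (Suc k))) =
      (\<Sum>k\<le>Suc n. (-1) ^ k * real (n choose k) * f k)"
    by (subst sum.atMost_Suc_shift) simp
  also have "\<dots> = (\<Sum>k\<le>n. (-1) ^ k * real (n choose k) * f k)"
    by simp
  finally show ?thesis
    by (simp add: algebra_simps sum_subtractf)
qed

section \<open>Polynomials under the shift x -> x + 1\<close>

lemma coeff_pcompose_shift_top:
  fixes p :: "real poly"
  assumes "degree p \<le> n"
  shows "coeff (pcompose p [:1, 1:]) n = coeff p n"
  using assms
proof (induction p arbitrary: n rule: pCons_induct)
  case (pCons a p)
  show ?case
  proof (cases n)
    case (Suc m)
    with pCons.prems have m: "degree p \<le> m" by (auto split: if_splits)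
    then have "coeff (pcompose p [:1, 1:]) (Suc m) = 0"
      by (intro coeff_eq_0) (simp add: degree_pcompose)
    with pCons.IH[OF m] Suc show ?thesis by (simp add: pcompose_pCons)
  qed (use pCons in \<open>auto simp: pcompose_pCons split: if_splits\<close>)
qed simp

text \<open>The extra term comes from \<open>(x + 1)^(n + 1)\<close>, whose coefficient at
  \<open>x^n\<close> is \<open>n + 1\<close>. In the induction, \<open>a + x p(x)\<close> becomes
  \<open>a + p(x + 1) + x p(x + 1)\<close>.\<close>

lemma coeff_pcompose_shift_below_top:
  fixes p :: "real poly"
  assumes "degree p \<le> Suc n"
  shows "coeff (pcompose p [:1, 1:]) n = coeff p n + real (Suc n) * coeff p (Suc n)"
  using assms
proof (induction p arbitrary: n rule: pCons_induct)
  case (pCons a p)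
  from pCons.prems have n: "degree p \<le> n" by (auto split: if_splits)
  note top = coeff_pcompose_shift_top[OF n]
  show ?case
  proof (cases n)
    case 0
    with top show ?thesis by (simp add: pcompose_pCons)
  next
    case (Suc m)
    with n pCons.IH[of m] top show ?thesis
      by (simp add: pcompose_pCons algebra_simps)
  qed
qed simp

text \<open>Passing from \<open>p(x)\<close> to \<open>p(x) - p(x + 1)\<close> lowers the degree
  bound by one and turns the coefficient \<open>c\<close> at \<open>n + 1\<close> into
  \<open>-(n + 1) c\<close> at \<open>n\<close>; repeating this ends in a constant.\<close>

lemma alternating_binomial_poly:
  fixes p :: "real poly"
  assumes "degree p \<le> n"
  shows "(\<Sum>k\<le>n. (-1) ^ k * real (n choose k) * poly p (real k)) = (-1) ^ n * fact n * coeff p n"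
  using assms
proof (induction n arbitrary: p)
  case 0
  then show ?case by (simp add: poly_0_coeff_0)
next
  case (Suc n)
  define q where "q = p - pcompose p [:1, 1:]"
  have "coeff q i = 0" if "n < i" for i
  proof (cases "i = Suc n")
    case True
    then show ?thesis using Suc.prems coeff_pcompose_shift_top by (simp add: q_def)
  next
    case False
    with that Suc.prems have "degree p < i" by simp
    then show ?thesis by (simp add: q_def coeff_eq_0 degree_pcompose)
  qed
  then have deg: "degree q \<le> n" by (intro degree_le) auto
  have "(\<Sum>k\<le>Suc n. (-1) ^ k * real (Suc n choose k) * poly p (real k)) =
      (\<Sum>k\<le>n. (-1) ^ k * real (n choose k) * poly q (real k))"
    by (simp only: alternating_binomial_Suc) (simp add: q_def poly_pcompose)
  also have "\<dots> = (-1) ^ n * fact n * coeff q n"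
    using Suc.IH[OF deg] .
  also have "\<dots> = (-1) ^ Suc n * fact (Suc n) * coeff p (Suc n)"
    using coeff_pcompose_shift_below_top[OF Suc.prems] by (simp add: q_def algebra_simps)
  finally show ?case .
qed

text \<open>Entrywise form of the alternating binomial sum of the matrices
  \<open>\<U>^k M (\<U>^(\<eta> - k))\<^sup>T\<close>.\<close>

definition antidiag_diff :: "imat \<Rightarrow> nat \<Rightarrow> imat" where
  "antidiag_diff M \<eta> =
     (\<lambda>i j. \<Sum>k\<le>\<eta>. (-1) ^ k * real (\<eta> choose k) * M (i + k) (j + (\<eta> - k)))"

lemma antidiag_diff_Suc:
  "antidiag_diff M (Suc \<eta>) i j = antidiag_diff M \<eta> i (Suc j) - antidiag_diff M \<eta> (Suc i) j"
proof -
  have "antidiag_diff M (Suc \<eta>) i j = (\<Sum>k\<le>\<eta>. (-1) ^ k * real (\<eta> choose k) *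
      (M (i + k) (j + (Suc \<eta> - k)) - M (i + Suc k) (j + (Suc \<eta> - Suc k))))"
    unfolding antidiag_diff_def by (rule alternating_binomial_Suc)
  also have "\<dots> = antidiag_diff M \<eta> i (Suc j) - antidiag_diff M \<eta> (Suc i) j"
    unfolding antidiag_diff_def sum_subtractf[symmetric]
    by (intro sum.cong) (auto simp: Suc_diff_le algebra_simps)
  finally show ?thesis .
qed

lemma antidiag_diff_zero_mono:
  assumes "antidiag_diff M \<eta> = \<O>" "\<eta> \<le> \<eta>'"
  shows "antidiag_diff M \<eta>' = \<O>"
  using assms(2,1)
proof (induction \<eta>' rule: dec_induct)
  case (step m)
  then show ?case by (auto simp: fun_eq_iff antidiag_diff_Suc null_imat_def)
qed

subsection \<open>Hankel-Sobolev sums\<close>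

lemma pow_shift: "pow_imat \<U> k i j = (if i + k = j then 1 else 0)"
proof (induction k arbitrary: i)
  case 0
  then show ?case by (simp add: unit_imat_def)
next
  case (Suc k)
  have "pow_imat \<U> (Suc k) i j = \<U> i (Suc i) * pow_imat \<U> k (Suc i) j"
    unfolding pow_imat.simps mult_imat_def
    by (rule Sum_any_single) (auto simp: shift_imat_def)
  also have "\<dots> = (if i + Suc k = j then 1 else 0)"
    by (simp only: Suc.IH) (simp add: shift_imat_def)
  finally show ?case .
qed

lemma pow_shift_mult: "(pow_imat \<U> k \<odot> A) i j = A (i + k) j"
  unfolding mult_imat_def by (subst Sum_any_single[where a = "i + k"]) (auto simp: pow_shift)

lemma pow_transpose_shift: "pow_imat (\<U>\<^sup>T) k i j = (if j + k = i then 1 else 0)"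
proof (induction k arbitrary: i)
  case 0
  then show ?case by (simp add: unit_imat_def)
next
  case (Suc k)
  \<comment> \<open>At \<open>i = 0\<close> the index \<open>i - 1\<close> is 0, where
    \<open>\<U>\<^sup>T 0 0 = 0\<close> gives the right value.\<close>
  have "pow_imat (\<U>\<^sup>T) (Suc k) i j = \<U>\<^sup>T i (i - 1) * pow_imat (\<U>\<^sup>T) k (i - 1) j"
    unfolding pow_imat.simps mult_imat_def
    by (rule Sum_any_single) (auto simp: shift_imat_def)
  also have "\<dots> = (if j + Suc k = i then 1 else 0)"
    by (simp only: Suc.IH) (auto simp: shift_imat_def)
  finally show ?case .
qed

text \<open>The falling factorial, built from real differences so that it is a polynomial in
  \<open>i\<close> and vanishes at every natural \<open>i < k\<close>.\<close>

definition falling :: "nat \<Rightarrow> nat \<Rightarrow> real" where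
  "falling i k = (\<Prod>l<k. real i - real l)"

lemma falling_eq: "falling i k = (if k \<le> i then fact i / fact (i - k) else 0)"
proof -
  have "falling i k = fact k * real (i choose k)"
    by (simp add: falling_def binomial_gbinomial gbinomial_mult_fact lessThan_atLeast0)
  then show ?thesis by (simp add: binomial_fact)
qed

lemma hankel_entry:
  assumes "hankel H"
  shows "H i j = H 0 (i + j)"
  using assms by (induction i arbitrary: j) (auto simp: hankel_def, metis add_Suc_right)

text \<open>Shifting by \<open>k\<close> evaluates \<open>\<D> k\<close> at \<open>i - k\<close>,
  where its entry is \<open>i! / (i - k)!\<close>. For \<open>k > i\<close> or \<open>k > j\<close>
  a falling factorial is 0, so the truncated subtraction does no harm.\<close>

lemma hankel_sobolev_term:
  assumes "hankel H"
  shows "(pow_imat (\<U>\<^sup>T) k \<odot> \<D> k \<odot> H \<odot> \<D> k \<odot> pow_imat \<U> k) i j =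
    falling i k * falling j k * H 0 (i + j - 2 * k)"
proof -
  let ?L = "pow_imat (\<U>\<^sup>T) k \<odot> \<D> k"
  have L: "?L i a = (if a + k = i then falling i k else 0)" for i a
    unfolding mult_imat_def
    by (subst Sum_any_single[where a = a])
       (auto simp: pow_transpose_shift diag_imat_def falling_eq add.commute)
  have LH: "(?L \<odot> H) i a = (if k \<le> i then falling i k * H (i - k) a else 0)" for i a
    by (subst mult_imat_def[of ?L], subst Sum_any_single[where a = "i - k"]) (auto simp: L)
  have LHD: "(?L \<odot> H \<odot> \<D> k) i a = (?L \<odot> H) i a * \<D> k a a" for i a
    by (subst mult_imat_def[of "?L \<odot> H"], rule Sum_any_single) (auto simp: diag_imat_def)
  have D: "\<D> k a a = fact (k + a) / fact a" for a
    by (simp add: diag_imat_def)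
  have "(?L \<odot> H \<odot> \<D> k \<odot> pow_imat \<U> k) i j =
      (?L \<odot> H \<odot> \<D> k) i (j - k) * pow_imat \<U> k (j - k) j"
    by (subst mult_imat_def[of "?L \<odot> H \<odot> \<D> k"], rule Sum_any_single) (auto simp: pow_shift)
  also have "\<dots> = falling i k * falling j k * H 0 (i + j - 2 * k)"
  proof (cases "k \<le> i \<and> k \<le> j")
    case True
    then have "H (i - k) (j - k) = H 0 (i + j - 2 * k)"
      by (subst hankel_entry[OF assms]) (simp add: mult_2)
    with True show ?thesis
      by (simp add: LHD LH D pow_shift falling_eq)
  next
    case False
    then show ?thesis by (auto simp: LHD LH pow_shift falling_eq)
  qed
  finally show ?thesis .
qed

text \<open>A summand with \<open>k > min i j\<close> is 0 anyway, so \<open>zero\<close> concerns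
  only \<open>2 * k \<le> i + j\<close>. This locality serves the later elimination, which knows
  each \<open>H k\<close> only on some antidiagonals.\<close>

lemma hankel_sobolev_sum_eq:
  assumes H: "\<And>k. hankel (H k)"
    and zero: "\<And>k. N < k \<Longrightarrow> 2 * k \<le> i + j \<Longrightarrow> H k 0 (i + j - 2 * k) = 0"
  shows "hankel_sobolev_sum H i j =
    (\<Sum>k\<le>N. falling i k * falling j k * H k 0 (i + j - 2 * k))"
  unfolding hankel_sobolev_sum_def hankel_sobolev_term[OF H]
proof (rule Sum_any.expand_superset)
  show "{k. falling i k * falling j k * H k 0 (i + j - 2 * k) \<noteq> 0} \<subseteq> {..N}"
  proof
    fix k assume "k \<in> {k. falling i k * falling j k * H k 0 (i + j - 2 * k) \<noteq> 0}"
    then have "k \<le> i" "k \<le> j" "H k 0 (i + j - 2 * k) \<noteq> 0"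
      by (auto simp: falling_eq split: if_splits)
    with zero[of k] show "k \<in> {..N}" by (auto simp: not_less[symmetric])
  qed
qed simp

section \<open>Differences of Hankel-Sobolev sums\<close>

definition antidiag_poly :: "nat \<Rightarrow> nat \<Rightarrow> nat \<Rightarrow> real poly" where
  "antidiag_poly i s k =
     (\<Prod>l<k. [:real i - real l, 1:]) * (\<Prod>l<k. [:real s - real l, -1:])"

lemma poly_antidiag_poly:
  assumes "a \<le> s"
  shows "poly (antidiag_poly i s k) (real a) = falling (i + a) k * falling (s - a) k"
  using assms by (simp add: antidiag_poly_def poly_prod falling_def of_nat_diff algebra_simps)

lemma degree_linear_prod:
  fixes c :: real
  assumes "c \<noteq> 0"
  shows "degree (\<Prod>l<k. [:b l, c:]) = k" "coeff (\<Prod>l<k. [:b l, c:]) k = c ^ k"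
proof -
  have deg: "degree (\<Prod>l<k. [:b l, c:]) = k"
    by (subst degree_prod_eq_sum_degree) (use assms in auto)
  have "lead_coeff (\<Prod>l<k. [:b l, c:]) = c ^ k"
    using assms by (simp add: lead_coeff_prod)
  with deg show "degree (\<Prod>l<k. [:b l, c:]) = k" "coeff (\<Prod>l<k. [:b l, c:]) k = c ^ k"
    by auto
qed

text \<open>The two products are the falling factorials of \<open>i + x\<close> and
  \<open>s - x\<close>, of degree \<open>k\<close> with leading coefficients 1 and
  \<open>(-1)^k\<close>.\<close>

lemma antidiag_poly_top:
  shows "degree (antidiag_poly i s k) \<le> 2 * k" "coeff (antidiag_poly i s k) (2 * k) = (-1) ^ k"
proof -
  let ?p = "\<Prod>l<k. [:real i - real l, 1:]" and ?q = "\<Prod>l<k. [:real s - real l, -1:]"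
  have p: "degree ?p = k" "coeff ?p k = 1" and q: "degree ?q = k" "coeff ?q k = (-1) ^ k"
    using degree_linear_prod[of 1 "\<lambda>l. real i - real l" k]
      degree_linear_prod[of "-1" "\<lambda>l. real s - real l" k] by auto
  show "degree (antidiag_poly i s k) \<le> 2 * k"
    using degree_mult_le[of ?p ?q] p q by (simp add: antidiag_poly_def)
  have "coeff (?p * ?q) (degree ?p + degree ?q) = (-1) ^ k"
    unfolding coeff_mult_degree_sum using p q by simp
  then show "coeff (antidiag_poly i s k) (2 * k) = (-1) ^ k"
    using p q by (simp add: antidiag_poly_def mult_2)
qed

text \<open>Along the antidiagonal, summand \<open>k\<close> is a constant times a polynomial of
  degree at most \<open>2 * k\<close>. Its \<open>\<eta>\<close>th difference is 0 for
  \<open>2 * k < \<eta>\<close> and reads off the top coefficient for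
  \<open>2 * k = \<eta>\<close>.\<close>

lemma antidiag_diff_hankel_sobolev_sum:
  assumes H: "\<And>k. hankel (H k)"
    and zero: "\<And>k a b. d < k \<Longrightarrow> a + b + 2 * k = i + j + \<eta> \<Longrightarrow> H k a b = 0"
    and \<eta>: "2 * d \<le> \<eta>"
  shows "antidiag_diff (hankel_sobolev_sum H) \<eta> i j =
    (if \<eta> = 2 * d then (-1) ^ d * fact (2 * d) * H d i j else 0)"
proof -
  let ?n = "i + j + \<eta>"
  let ?w = "\<lambda>a. (-1) ^ a * real (\<eta> choose a)"
  let ?P = "\<lambda>k. antidiag_poly i (j + \<eta>) k"
  have entry: "hankel_sobolev_sum H (i + a) (j + (\<eta> - a)) =
      (\<Sum>k\<le>d. poly (?P k) (real a) * H k 0 (?n - 2 * k))" if a: "a \<le> \<eta>" for a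
  proof -
    have n: "i + a + (j + (\<eta> - a)) = ?n" using a by simp
    have "hankel_sobolev_sum H (i + a) (j + (\<eta> - a)) =
        (\<Sum>k\<le>d. falling (i + a) k * falling (j + (\<eta> - a)) k * H k 0 (?n - 2 * k))"
      unfolding n[symmetric]
      by (rule hankel_sobolev_sum_eq[OF H]) (use a zero in auto)
    also have "\<dots> = (\<Sum>k\<le>d. poly (?P k) (real a) * H k 0 (?n - 2 * k))"
      using a by (intro sum.cong) (auto simp: poly_antidiag_poly)
    finally show ?thesis .
  qed
  have diff: "(\<Sum>a\<le>\<eta>. ?w a * poly (?P k) (real a)) =
      (if \<eta> = 2 * k then (-1) ^ k * fact (2 * k) else 0)" if "k \<le> d" for k
  proof -
    have le: "degree (?P k) \<le> 2 * k" by (rule antidiag_poly_top)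
    with that \<eta> have "degree (?P k) \<le> \<eta>" by linarith
    from alternating_binomial_poly[OF this] show ?thesis
    proof (cases "\<eta> = 2 * k")
      case False
      with le that \<eta> have "coeff (?P k) \<eta> = 0" by (intro coeff_eq_0) linarith
      with False alternating_binomial_poly[OF \<open>degree (?P k) \<le> \<eta>\<close>] show ?thesis by simp
    qed (simp add: antidiag_poly_top)
  qed
  have "antidiag_diff (hankel_sobolev_sum H) \<eta> i j =
      (\<Sum>a\<le>\<eta>. \<Sum>k\<le>d. ?w a * poly (?P k) (real a) * H k 0 (?n - 2 * k))"
    unfolding antidiag_diff_def
    by (intro sum.cong refl) (simp add: entry sum_distrib_left mult.assoc del: add_diff_assoc)
  also have "\<dots> = (\<Sum>k\<le>d. (\<Sum>a\<le>\<eta>. ?w a * poly (?P k) (real a)) * H k 0 (?n - 2 * k))"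
    by (subst sum.swap) (simp add: sum_distrib_right)
  \<comment> \<open>\<open>\<eta> = 2 * k\<close> makes \<open>?n - 2 * k\<close> equal to
    \<open>i + j\<close>, so the Hankel property returns \<open>H k i j\<close>.\<close>
  also have "\<dots> = (\<Sum>k\<le>d. (if \<eta> = 2 * k then (-1) ^ k * fact (2 * k) * H k i j else 0))"
    by (intro sum.cong refl) (simp add: diff hankel_entry[OF H, of _ i j])
  \<comment> \<open>\<open>k \<le> d\<close> and \<open>2 * d \<le> \<eta>\<close> leave
    \<open>k = d\<close> as the only case of \<open>\<eta> = 2 * k\<close>.\<close>
  also have "\<dots> = (\<Sum>k\<le>d. if k = d then
      (if \<eta> = 2 * d then (-1) ^ d * fact (2 * d) * H d i j else 0) else 0)"
    using \<eta> by (intro sum.cong) auto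
  finally show ?thesis by simp
qed

section \<open>Existence of Hankel coefficients and the index criterion\<close>

lemma symmetric_imp_hankel_sobolev_sum:
  assumes sym: "M\<^sup>T = M"
  shows "\<exists>H. (\<forall>k. hankel (H k)) \<and> M = hankel_sobolev_sum H"
proof -
  \<comment> \<open>On the antidiagonal \<open>i + j = n\<close> the unknowns are the values of
    \<open>H k\<close> at index sum \<open>n - 2 * k\<close>, and row \<open>i\<close> gives an
    equation with coefficients \<open>A n i k\<close>. The diagonal entry \<open>A n i i\<close> is
    nonzero for \<open>2 * i \<le> n\<close>, which covers every pivot that \<open>H\<close>
    uses.\<close>
  define A where "A n i k = falling i k * falling (n - i) k" for n i k
  define H where "H k i j = forward_subst (A (i + j + 2 * k)) (\<lambda>i'. M i' (i + j + 2 * k - i')) k"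
    for k i j
  have hankel: "hankel (H k)" for k
    by (simp add: hankel_def H_def)
  have half: "M i j = hankel_sobolev_sum H i j" if "i \<le> j" for i j
  proof -
    let ?n = "i + j"
    have "hankel_sobolev_sum H i j =
        (\<Sum>k\<le>?n. falling i k * falling j k * H k 0 (?n - 2 * k))"
      by (rule hankel_sobolev_sum_eq[OF hankel]) simp
    also have "\<dots> = (\<Sum>k\<le>i. falling i k * falling j k * H k 0 (?n - 2 * k))"
      by (rule sum.mono_neutral_right) (auto simp: falling_eq)
    also have "\<dots> = (\<Sum>k\<le>i. A ?n i k * forward_subst (A ?n) (\<lambda>i'. M i' (?n - i')) k)"
      using that by (intro sum.cong) (auto simp: A_def H_def)
    also have "\<dots> = M i j"
      by (subst forward_subst_solves) (use that in \<open>auto simp: A_def falling_eq\<close>)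
    finally show ?thesis by simp
  qed
  have Hsym: "hankel_sobolev_sum H i j = hankel_sobolev_sum H j i" for i j
    by (simp add: hankel_sobolev_sum_def hankel_sobolev_term[OF hankel] ac_simps)
  have Msym: "M i j = M j i" for i j
    using sym by (metis transpose_imat_apply)
  have "M = hankel_sobolev_sum H"
  proof (intro ext)
    fix i j
    show "M i j = hankel_sobolev_sum H i j"
      using half[of i j] half[of j i] Hsym[of i j] Msym[of i j] by (cases "i \<le> j") auto
  qed
  with hankel show ?thesis by blast
qed

lemma hankel_sobolev_of_index_iff:
  assumes sym: "M\<^sup>T = M"
  shows "hankel_sobolev_of_index M d \<longleftrightarrow>
    antidiag_diff M (2 * d + 1) = \<O> \<and> antidiag_diff M (2 * d) \<noteq> \<O>"
proof
  assume "hankel_sobolev_of_index M d"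
  then obtain H where H: "\<And>k. hankel (H k)" "M = hankel_sobolev_sum H" "H d \<noteq> \<O>"
    and zero: "\<And>k. d < k \<Longrightarrow> H k = \<O>"
    unfolding hankel_sobolev_of_index_def by blast
  note diff = antidiag_diff_hankel_sobolev_sum[OF H(1), of d]
  from H(3) obtain i j where "H d i j \<noteq> 0" by (auto simp: null_imat_def fun_eq_iff)
  then have "antidiag_diff M (2 * d) i j \<noteq> 0"
    by (subst H(2), subst diff) (auto simp: zero null_imat_def)
  moreover have "antidiag_diff M (2 * d + 1) = \<O>"
    by (subst H(2), intro ext, subst diff) (auto simp: zero null_imat_def)
  ultimately show "antidiag_diff M (2 * d + 1) = \<O> \<and> antidiag_diff M (2 * d) \<noteq> \<O>"
    by (auto simp: null_imat_def)
next
  assume D: "antidiag_diff M (2 * d + 1) = \<O> \<and> antidiag_diff M (2 * d) \<noteq> \<O>"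
  obtain H where H: "\<And>k. hankel (H k)" "M = hankel_sobolev_sum H"
    using symmetric_imp_hankel_sobolev_sum[OF sym] by blast
  note diff = antidiag_diff_hankel_sobolev_sum[OF H(1)]
  \<comment> \<open>On a fixed antidiagonal of \<open>M\<close> a larger \<open>k\<close> means a smaller \<open>i + j\<close>, so this induction
    eliminates the summands of highest degree first.\<close>
  have zero: "H k i j = 0" if "d < k" for k i j
    using that
  proof (induction "i + j" arbitrary: i j k rule: less_induct)
    case less
    have "antidiag_diff M (2 * k) i j = 0"
      using antidiag_diff_zero_mono[of M "2 * d + 1" "2 * k"] D less.prems
      by (simp add: null_imat_def)
    moreover have "antidiag_diff M (2 * k) i j = (-1) ^ k * fact (2 * k) * H k i j"
      by (subst H(2), subst diff[of k]) (use less in auto)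
    ultimately show ?case by simp
  qed
  have "H d \<noteq> \<O>"
  proof
    assume "H d = \<O>"
    then have "antidiag_diff M (2 * d) = \<O>"
      by (subst H(2), intro ext, subst diff[of d]) (auto simp: zero null_imat_def)
    with D show False by simp
  qed
  moreover have "H k = \<O>" if "d < k" for k
    using zero[OF that] by (simp add: null_imat_def fun_eq_iff)
  ultimately show "hankel_sobolev_of_index M d"
    unfolding hankel_sobolev_of_index_def using H by blast
qed

subsection \<open>The coefficient matrix intertwines the Hessenberg matrix and the shift\<close>

lemma degree_gen_poly: "degree (gen_poly G t n) \<le> n"
proof (induction n rule: less_induct)
  case (less n)
  show ?case
  proof (cases n)
    case (Suc m)
    have "degree (\<Sum>k\<in>{0..m}. smult (G m k) (gen_poly G t k)) \<le> m"
      by (rule degree_sum_le)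
         (use less Suc in \<open>auto intro: order_trans[OF degree_smult_le] order_trans[OF less]\<close>)
    moreover have "degree ([:0, 1:] * gen_poly G t m) \<le> Suc m"
      using degree_mult_le[of "[:0, 1:]" "gen_poly G t m"] less[of m] Suc by simp
    ultimately show ?thesis
      unfolding Suc gen_poly.simps
      by (intro order_trans[OF degree_smult_le] degree_diff_le) auto
  qed simp
qed

text \<open>Subtracting the earlier polynomials leaves the leading coefficient alone, so each step
  divides it by \<open>G n (n + 1)\<close>.\<close>

lemma coeff_gen_poly_top:
  assumes "\<And>i. G i (i + 1) \<noteq> 0" "t \<noteq> 0"
  shows "coeff (gen_poly G t n) n \<noteq> 0"
proof (induction n)
  case (Suc n)
  have "coeff (gen_poly G t k) (Suc n) = 0" if "k \<le> n" for k
    using degree_gen_poly[of G t k] that by (intro coeff_eq_0) simp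
  with Suc assms show ?case by (simp add: coeff_sum)
qed (use assms in simp)

text \<open>Row \<open>n\<close> of either side lists the coefficients of \<open>x Q_n\<close>: on
  the left by the recurrence, on the right because \<open>\<U>\<close> moves the row of
  \<open>Q_n\<close> one place to the right.\<close>

lemma hessenberg_mult_coeff_imat:
  assumes "nondegenerate_hessenberg G"
  shows "G \<odot> coeff_imat G t = coeff_imat G t \<odot> \<U>"
proof (intro ext)
  fix n j
  have G: "G i j = 0" if "Suc i < j" for i j
    using assms that by (simp add: nondegenerate_hessenberg_def)
  have G1: "G n (Suc n) \<noteq> 0"
    using assms by (simp add: nondegenerate_hessenberg_def)
  have rec: "(\<Sum>k\<le>Suc n. smult (G n k) (gen_poly G t k)) = [:0, 1:] * gen_poly G t n"
    using G1 by (simp add: atLeast0AtMost)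
  have "(G \<odot> coeff_imat G t) n j = (\<Sum>k\<le>Suc n. G n k * coeff_imat G t k j)"
    by (rule mult_imat_upper_band) (simp add: G)
  also have "\<dots> = coeff (\<Sum>k\<le>Suc n. smult (G n k) (gen_poly G t k)) j"
    by (simp add: coeff_sum coeff_imat_def)
  also have "\<dots> = (if j = 0 then 0 else coeff_imat G t n (j - 1))"
    by (subst rec) (simp add: coeff_pCons coeff_imat_def split: nat.split)
  \<comment> \<open>For \<open>j = 0\<close> the index \<open>j - 1\<close> is 0 and
    \<open>\<U> 0 0 = 0\<close>, which absorbs the case distinction.\<close>
  also have "\<dots> = coeff_imat G t n (j - 1) * \<U> (j - 1) j"
    by (simp add: shift_imat_def)
  also have "\<dots> = (coeff_imat G t \<odot> \<U>) n j"
    unfolding mult_imat_def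
    by (subst Sum_any_single[where a = "j - 1"]) (auto simp: shift_imat_def)
  finally show "(G \<odot> coeff_imat G t) n j = (coeff_imat G t \<odot> \<U>) n j" .
qed

section \<open>Congruence by a lower triangular matrix\<close>

lemma lower_triangular_congruence:
  assumes "lower_triangular A"
  shows "(A \<odot> X \<odot> A\<^sup>T) i j = (\<Sum>a\<le>i. \<Sum>b\<le>j. A i a * X a b * A j b)"
proof -
  have A: "A i k = 0" if "i < k" for i k
    using assms that by (simp add: lower_triangular_def)
  have left: "(A \<odot> Y) i j = (\<Sum>a\<le>i. A i a * Y a j)" for Y i j
    by (rule mult_imat_upper_band) (rule A)
  have "(A \<odot> X \<odot> A\<^sup>T) i j = (A \<odot> X \<odot> A\<^sup>T)\<^sup>T j i" by simp
  also have "\<dots> = (\<Sum>b\<le>j. \<Sum>a\<le>i. A i a * X a b * A j b)"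
    unfolding transpose_mult_imat[of "A \<odot> X"] transpose_transpose_imat left[of _ j]
    by (simp add: left sum_distrib_left ac_simps)
  finally show ?thesis by (subst sum.swap)
qed

text \<open>\<open>G T = T \<U>\<close> gives \<open>G^n = T \<U>^n S\<close>. Hence
  \<open>G^k (G^m)\<^sup>T\<close> is the congruence by \<open>T\<close> of
  \<open>\<U>^k S S\<^sup>T (\<U>^m)\<^sup>T\<close>, which is \<open>S S\<^sup>T\<close> moved up
  by \<open>k\<close> rows and left by \<open>m\<close> columns.\<close>

lemma Psi_eq_congruence:
  assumes G: "row_finite G"
    and T: "lower_triangular T" and S: "lower_triangular S"
    and TS: "T \<odot> S = \<I>"
    and GT: "G \<odot> T = T \<odot> \<U>"
  shows "\<Psi> G \<eta> = T \<odot> antidiag_diff (S \<odot> S\<^sup>T) \<eta> \<odot> T\<^sup>T"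
proof -
  let ?M = "S \<odot> S\<^sup>T"
  have U: "row_finite \<U>"
    by (rule row_finite_upper_band[of 1]) (auto simp: shift_imat_def)
  note fin = G row_finite_lower_triangular[OF T] row_finite_lower_triangular[OF S]
    row_finite_mult row_finite_pow[OF G] row_finite_pow[OF U] U
  have pow: "pow_imat G n \<odot> T = T \<odot> pow_imat \<U> n" for n
  proof (induction n)
    case (Suc n)
    have "pow_imat G (Suc n) \<odot> T = G \<odot> T \<odot> pow_imat \<U> n"
      by (simp add: mult_imat_assoc fin Suc.IH)
    then show ?case by (simp add: GT mult_imat_assoc fin)
  qed simp
  have powG: "pow_imat G n = T \<odot> (pow_imat \<U> n \<odot> S)" for n
  proof -
    have "pow_imat G n = pow_imat G n \<odot> T \<odot> S"
      by (simp add: mult_imat_assoc fin TS)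
    then show ?thesis by (simp add: pow mult_imat_assoc fin)
  qed
  have prod: "pow_imat G k \<odot> (pow_imat G m)\<^sup>T =
      T \<odot> (\<lambda>i j. ?M (i + k) (j + m)) \<odot> T\<^sup>T" for k m
  proof -
    have shift: "pow_imat \<U> k \<odot> S \<odot> (pow_imat \<U> m \<odot> S)\<^sup>T = (\<lambda>i j. ?M (i + k) (j + m))"
      by (simp add: mult_imat_def fun_eq_iff pow_shift_mult[unfolded mult_imat_def])
    have "pow_imat G k \<odot> (pow_imat G m)\<^sup>T =
        T \<odot> (pow_imat \<U> k \<odot> S) \<odot> ((pow_imat \<U> m \<odot> S)\<^sup>T \<odot> T\<^sup>T)"
      by (simp only: powG transpose_mult_imat[of T])
    also have "\<dots> = T \<odot> (pow_imat \<U> k \<odot> S \<odot> (pow_imat \<U> m \<odot> S)\<^sup>T \<odot> T\<^sup>T)"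
      by (simp add: mult_imat_assoc fin)
    \<comment> \<open>The middle factor need not be row-finite; this regrouping rests on
      \<open>T\<^sup>T\<close> having finite columns.\<close>
    also have "\<dots> = T \<odot> (pow_imat \<U> k \<odot> S \<odot> (pow_imat \<U> m \<odot> S)\<^sup>T) \<odot> T\<^sup>T"
      by (rule mult_imat_assoc[symmetric]) (simp_all add: fin)
    finally show ?thesis by (simp only: shift)
  qed
  show ?thesis
  proof (intro ext)
    fix i j
    let ?w = "\<lambda>k. (-1) ^ k * real (\<eta> choose k)"
    let ?f = "\<lambda>k a b. T i a * ?M (a + k) (b + (\<eta> - k)) * T j b"
    have "\<Psi> G \<eta> i j = (\<Sum>k\<le>\<eta>. \<Sum>a\<le>i. \<Sum>b\<le>j. ?w k * ?f k a b)"
      unfolding Psi_def prod lower_triangular_congruence[OF T] atLeast0AtMost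
      by (simp add: sum_distrib_left)
    also have "\<dots> = (\<Sum>a\<le>i. \<Sum>b\<le>j. \<Sum>k\<le>\<eta>. ?w k * ?f k a b)"
      unfolding sum.swap[of _ _ "{..\<eta>}"] ..
    also have "\<dots> = (T \<odot> antidiag_diff ?M \<eta> \<odot> T\<^sup>T) i j"
      unfolding lower_triangular_congruence[OF T] antidiag_diff_def
      by (simp add: sum_distrib_left sum_distrib_right ac_simps)
    finally show "\<Psi> G \<eta> i j = (T \<odot> antidiag_diff ?M \<eta> \<odot> T\<^sup>T) i j" .
  qed
qed

text \<open>Multiplying by \<open>S\<close> on the left and by \<open>S\<^sup>T\<close> on the right
  cancels the outer factors.\<close>

lemma congruence_eq_null_iff:
  assumes T: "lower_triangular T" and S: "lower_triangular S" and ST: "S \<odot> T = \<I>"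
  shows "T \<odot> X \<odot> T\<^sup>T = \<O> \<longleftrightarrow> X = \<O>"
proof
  note fin = row_finite_lower_triangular[OF T] row_finite_lower_triangular[OF S]
  have ST': "T\<^sup>T \<odot> S\<^sup>T = \<I>"
    using ST by (metis transpose_mult_imat transpose_unit_imat)
  assume null: "T \<odot> X \<odot> T\<^sup>T = \<O>"
  have "X = S \<odot> (T \<odot> (X \<odot> (T\<^sup>T \<odot> S\<^sup>T)))"
    by (simp add: mult_imat_assoc[symmetric] fin ST ST')
  also have "X \<odot> (T\<^sup>T \<odot> S\<^sup>T) = X \<odot> T\<^sup>T \<odot> S\<^sup>T"
    \<comment> \<open>\<open>X\<close> need not be row-finite, so associativity is applied to the transposes.\<close>
  proof -
    have "(X \<odot> (T\<^sup>T \<odot> S\<^sup>T))\<^sup>T = (X \<odot> T\<^sup>T \<odot> S\<^sup>T)\<^sup>T"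
      by (simp add: transpose_mult_imat mult_imat_assoc fin)
    then show ?thesis by (metis transpose_transpose_imat)
  qed
  also have "S \<odot> (T \<odot> (X \<odot> T\<^sup>T \<odot> S\<^sup>T)) = S \<odot> (T \<odot> X \<odot> T\<^sup>T \<odot> S\<^sup>T)"
    by (simp add: mult_imat_assoc fin)
  also have "\<dots> = \<O>"
    unfolding null by (simp add: mult_imat_def null_imat_def)
  finally show "X = \<O>" .
next
  assume "X = \<O>"
  then show "T \<odot> X \<odot> T\<^sup>T = \<O>"
    by (simp add: mult_imat_def null_imat_def)
qed

theorem theorem2:
  fixes G :: imat and t00 :: real and d :: nat
  assumes "nondegenerate_hessenberg G"
    and "t00 > 0"
  shows "hessenberg_sobolev_of_index G t00 d \<longleftrightarrow>
    \<Psi> G (2 * d + 1) = \<O> \<and> \<Psi> G (2 * d) \<noteq> \<O>"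
proof -
  define T where "T = coeff_imat G t00"
  define S where "S = lt_inverse T"
  have G: "row_finite G"
    using assms(1) by (intro row_finite_upper_band[of 1]) (simp add: nondegenerate_hessenberg_def)
  have T: "lower_triangular T"
    unfolding lower_triangular_def T_def coeff_imat_def
    using degree_gen_poly[of G t00] by (meson coeff_eq_0 le_less_trans)
  have "T i i \<noteq> 0" for i
    using assms coeff_gen_poly_top[of G t00 i]
    by (simp add: T_def coeff_imat_def nondegenerate_hessenberg_def)
  note S = lt_inverse[OF T this, folded S_def]
  \<comment> \<open>Congruence by \<open>T\<close> preserves and reflects vanishing at every order,
    so both \<open>2 * d + 1\<close> and \<open>2 * d\<close> are covered.\<close>
  have "\<Psi> G \<eta> = \<O> \<longleftrightarrow> antidiag_diff (S \<odot> S\<^sup>T) \<eta> = \<O>" for \<eta>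
    unfolding Psi_eq_congruence[OF G T S(1,2)
        hessenberg_mult_coeff_imat[OF assms(1), of t00, folded T_def]]
    by (rule congruence_eq_null_iff[OF T S(1,3)])
  moreover have "(S \<odot> S\<^sup>T)\<^sup>T = S \<odot> S\<^sup>T"
    by (simp add: transpose_mult_imat)
  ultimately show ?thesis
    unfolding hessenberg_sobolev_of_index_def moment_imat_def
    by (simp add: hankel_sobolev_of_index_iff flip: T_def S_def)
qed

end
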